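(* Let $(X,d,\preceq)$ be a complete ordered $L_{\downarrow}$ metric space. Suppose that $T,S:X\to B(X)$ are two partially dominated mappings which satisfy the generalized $(\psi,\varphi)$-weak contractive condition $$\psi(\delta(Sx,Ty))\le \psi(M(x,y))-\varphi(M(x,y))\quad\text{for all }(x,y)\in X_{\preceq},$$ where $$M(x,y)=\max\left\{d(x,y),\ \delta(x,Sx),\ \delta(y,Ty),\ \tfrac12\big(D(x,Ty)+D(y,Sx)\big)\right\},$$ $\psi\in\Upsilon$, and $\varphi:\mathbb{R}_{\ge 0}\to\mathbb{R}_{\ge 0}$ satisfies, for every sequence $\{t_n\}\subset\mathbb{R}_{\ge 0}$: if $\varphi(t_n)\to 0$ as $n\to\infty$, then $t_n\to 0$ as $n\to\infty$. Then there exists a point $u\in X$ such that $\{u\}=Tu=Su$. Moreover, if the end points of $S$ and $T$ are comparable, then $S$ and $T$ have a unique common end point.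
   Context: $\mathbb{R}_{\ge 0}$ is the set of nonnegative reals. A complete ordered $L_{\downarrow}$ metric space $(X,d,\preceq)$ is a nonempty set $X$ with a complete metric $d$ and a partial order $\preceq$ such that whenever $x_n\to x$ in $(X,d)$ and $x_{n+1}\preceq x_n$ for each $n\ge 1$, one has $x\preceq x_n$ for each $n\ge 1$. Two points $x,y$ are comparable if $x\preceq y$ or $y\preceq x$; $X_{\preceq}=\{(x,y)\in X^2: x\preceq y\text{ or }y\preceq x\}$. $B(X)$ is the class of all nonempty bounded subsets of $X$. For $A,B\in B(X)$, $\delta(A,B)=\sup\{d(a,b):a\in A,\ b\in B\}$ and $D(A,B)=\inf\{d(a,b):a\in A,\ b\in B\}$; a singleton $\{a\}$ is written $a$ in these expressions. A mapping $T:X\to B(X)$ is partially dominated if for every $y\in X$ there exists some $x\in Ty$ such that $x\preceq y$. A point $x$ is an end point of $T$ if $Tx=\{x\}$; a common end point of $S$ and $T$ is a point $x$ with $Sx=Tx=\{x\}$. "The end points of $S$ and $T$ are comparable" means that any two points of $X$, each of which is an end point of $S$ or of $T$, are comparable. $\Upsilon$ is the collection of all non-decreasing functions $\psi:\mathbb{R}_{\ge 0}\to\mathbb{R}_{\ge 0}$ such that for every two sequences $\{a_n\},\{b_n\}$ in $\mathbb{R}_{\ge 0}$ with $\lim_{n\to\infty}a_n=\lim_{n\to\infty}b_n$ one has $\lim_{n\to\infty}\psi(a_n)=\lim_{n\to\infty}\psi(b_n)$ (equality of limits includes that the limits exist as real numbers). *)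

theory Defs
  imports "HOL-Analysis.Analysis"
begin

class complete_ordered_Ldown_metric_space = complete_space + order +
  assumes Ldown: "s \<longlonglongrightarrow> l \<Longrightarrow> (\<And>n. s (Suc n) \<le> s n) \<Longrightarrow> l \<le> s n"

definition comparable :: "'a::order \<Rightarrow> 'a \<Rightarrow> bool" where
  "comparable x y \<longleftrightarrow> x \<le> y \<or> y \<le> x"

definition bounded_sets :: "'a::metric_space set set" where
  "bounded_sets = {A. A \<noteq> {} \<and> bounded A}"

text \<open>The companion quantity \<open>D(A,B) = inf {d(a,b)}\<close> is \<open>setdist A B\<close> of the library.\<close>

definition delta :: "'a::metric_space set \<Rightarrow> 'a set \<Rightarrow> real" where
  "delta A B = Sup {dist a b | a b. a \<in> A \<and> b \<in> B}"

definition partially_dominated :: "('a::order \<Rightarrow> 'a set) \<Rightarrow> bool" where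
  "partially_dominated T \<longleftrightarrow> (\<forall>y. \<exists>x\<in>T y. x \<le> y)"

definition end_point :: "('a \<Rightarrow> 'a set) \<Rightarrow> 'a \<Rightarrow> bool" where
  "end_point T x \<longleftrightarrow> T x = {x}"

definition common_end_point :: "('a \<Rightarrow> 'a set) \<Rightarrow> ('a \<Rightarrow> 'a set) \<Rightarrow> 'a \<Rightarrow> bool" where
  "common_end_point S T x \<longleftrightarrow> S x = {x} \<and> T x = {x}"

definition end_points_comparable ::
    "('a::order \<Rightarrow> 'a set) \<Rightarrow> ('a \<Rightarrow> 'a set) \<Rightarrow> bool" where
  "end_points_comparable S T \<longleftrightarrow>
     (\<forall>x y. (end_point S x \<or> end_point T x) \<longrightarrow> (end_point S y \<or> end_point T y)
        \<longrightarrow> comparable x y)"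

text \<open>Functions from the nonnegative reals to themselves are total functions on \<open>real\<close>
  whose values outside \<open>{0..}\<close> are irrelevant.\<close>

definition Upsilon :: "(real \<Rightarrow> real) set" where
  "Upsilon = {\<psi>. \<psi> \<in> {0..} \<rightarrow> {0..} \<and> mono_on {0..} \<psi> \<and>
     (\<forall>a b :: nat \<Rightarrow> real. (\<forall>n. 0 \<le> a n) \<longrightarrow> (\<forall>n. 0 \<le> b n) \<longrightarrow>
        (\<exists>l. a \<longlonglongrightarrow> l \<and> b \<longlonglongrightarrow> l) \<longrightarrow>
        (\<exists>m. (\<lambda>n. \<psi> (a n)) \<longlonglongrightarrow> m \<and> (\<lambda>n. \<psi> (b n)) \<longlonglongrightarrow> m))}"

definition M :: "('a::metric_space \<Rightarrow> 'a set) \<Rightarrow> ('a \<Rightarrow> 'a set) \<Rightarrow> 'a \<Rightarrow> 'a \<Rightarrow> real" where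
  "M S T x y = Max {dist x y, delta {x} (S x), delta {y} (T y),
     (setdist {x} (T y) + setdist {y} (S x)) / 2}"

definition generalized_weak_contractive ::
    "(real \<Rightarrow> real) \<Rightarrow> (real \<Rightarrow> real) \<Rightarrow> ('a::{metric_space,order} \<Rightarrow> 'a set) \<Rightarrow>
     ('a \<Rightarrow> 'a set) \<Rightarrow> bool" where
  "generalized_weak_contractive \<psi> \<phi> S T \<longleftrightarrow>
     (\<forall>x y. comparable x y \<longrightarrow>
        \<psi> (delta (S x) (T y)) \<le> \<psi> (M S T x y) - \<phi> (M S T x y))"

end

theory Submission imports Defs begin

text \<open>The weak contractive condition enters only through one consequence, a uniform version of
  the Meir--Keeler condition: for every \<open>e > 0\<close> there is \<open>d > 0\<close> such that, for comparable
  \<open>x\<close> and \<open>y\<close>, \<open>M S T x y < e + d\<close> forces \<open>delta (S x) (T y) < e - d\<close>.  Indeed \<open>\<psi>\<close> is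
  continuous and \<open>\<phi>\<close> is bounded below by a positive constant away from \<open>0\<close>, so when \<open>M S T x y\<close>
  is near \<open>e\<close> the loss \<open>\<phi> (M S T x y)\<close> is larger than the oscillation of \<open>\<psi>\<close> around \<open>e\<close>
  (lemma \<open>weak_contractive_imp_gap\<close>).

  Because \<open>S\<close> and \<open>T\<close> are partially dominated, there is a decreasing sequence \<open>x\<close> whose terms are
  chosen alternately in the values of \<open>S\<close> and of \<open>T\<close>; all its terms are comparable.  The gap makes
  the numbers \<open>delta {x n} (G n (x n))\<close>, with \<open>G n\<close> alternating between \<open>S\<close> and \<open>T\<close>, decrease
  to \<open>0\<close>: they cannot stay above a positive limit \<open>e\<close> and also drop below \<open>e - d\<close>.  Consequently
  \<open>M\<close> at two terms of the orbit exceeds their distance by a vanishing error only, and the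
  classical Meir--Keeler induction confines the tail of the sequence to a small ball (lemma \<open>orbit_Cauchy\<close>).

  The limit \<open>u\<close> lies below every term, hence is comparable with each of them.  If
  \<open>A = delta {u} (S u)\<close> were positive, then \<open>M S T u (x n)\<close> would come close to \<open>A\<close>, so that
  \<open>delta (S u) (T (x n)) < A - d\<close>; since \<open>T (x n)\<close>, for odd \<open>n\<close>,
  contains the point \<open>x (Suc n)\<close>, which is near \<open>u\<close>, this contradicts the definition of \<open>A\<close>.  Thus
  \<open>S u = {u}\<close>.  The cases of \<open>T u\<close> and of uniqueness are immediate, since in both \<open>M\<close> equals the
  distance \<open>delta\<close> between the two values, which the gap makes smaller than \<open>M\<close>
  whenever \<open>M\<close> is positive.\<close>

section \<open>The distances between sets\<close>

lemma bdd_above_dist_pairs: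
  assumes "bounded A" "bounded B"
  shows "bdd_above {dist a b | a b. a \<in> A \<and> b \<in> B}"
proof -
  obtain c where c: "\<forall>a\<in>A \<union> B. \<forall>b\<in>A \<union> B. dist a b \<le> c"
    using assms by (meson bounded_Un bounded_two_points)
  show ?thesis
    by (rule bdd_aboveI[of _ c]) (use c in auto)
qed

lemma dist_le_delta:
  assumes "bounded A" "bounded B" "a \<in> A" "b \<in> B"
  shows "dist a b \<le> delta A B"
  unfolding delta_def
  by (rule cSup_upper[OF _ bdd_above_dist_pairs]) (use assms in auto)

lemma delta_least:
  assumes "A \<noteq> {}" "B \<noteq> {}" "\<And>a b. a \<in> A \<Longrightarrow> b \<in> B \<Longrightarrow> dist a b \<le> c"
  shows "delta A B \<le> c"
  unfolding delta_def by (rule cSup_least) (use assms in auto)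

lemma delta_nonneg:
  assumes "A \<in> bounded_sets" "B \<in> bounded_sets"
  shows "0 \<le> delta A B"
proof -
  obtain a b where "a \<in> A" "b \<in> B"
    using assms unfolding bounded_sets_def by auto
  then have "dist a b \<le> delta A B"
    using assms by (simp add: bounded_sets_def dist_le_delta)
  then show ?thesis
    using zero_le_dist[of a b] by linarith
qed

lemma delta_commute: "delta A B = delta B A"
  unfolding delta_def by (rule arg_cong[of _ _ Sup]) (auto simp: set_eq_iff, (metis dist_commute)+)

lemma delta_singletons [simp]: "delta {a} {b} = dist a b"
  unfolding delta_def by simp

lemma singleton_in_bounded_sets [simp]: "{a} \<in> bounded_sets"
  by (simp add: bounded_sets_def)

lemma dist_le_delta_singleton:
  assumes "A \<in> bounded_sets" "a \<in> A"
  shows "dist x a \<le> delta {x} A"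
  by (rule dist_le_delta) (use assms in \<open>auto simp: bounded_sets_def\<close>)

lemma delta_singleton_le:
  assumes "A \<in> bounded_sets" "B \<in> bounded_sets" "a \<in> A"
  shows "delta {a} B \<le> delta A B"
  by (rule delta_least) (use assms in \<open>auto simp: bounded_sets_def dist_le_delta\<close>)

lemma delta_singleton_nonpos_imp_eq:
  assumes "A \<in> bounded_sets" "delta {x} A \<le> 0"
  shows "A = {x}"
proof -
  have "a = x" if "a \<in> A" for a
  proof -
    have "dist x a \<le> 0"
      using dist_le_delta_singleton[OF assms(1) that, of x] assms(2) by linarith
    then show ?thesis by simp
  qed
  then show ?thesis
    using assms(1) unfolding bounded_sets_def by auto
qed

lemma M_less_iff:
  "M S T x y < c \<longleftrightarrow> dist x y < c \<and> delta {x} (S x) < c \<and> delta {y} (T y) < c \<and>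
     (setdist {x} (T y) + setdist {y} (S x)) / 2 < c"
  unfolding M_def by (subst Max_less_iff) auto

lemma M_ge:
  "dist x y \<le> M S T x y" "delta {x} (S x) \<le> M S T x y" "delta {y} (T y) \<le> M S T x y"
  unfolding M_def by (auto intro!: Max_ge)

lemma M_swap: "M T S y x = M S T x y"
  unfolding M_def by (rule arg_cong[of _ _ Max]) (auto simp: dist_commute add.commute)

lemma comparable_commute: "comparable x y \<longleftrightarrow> comparable y x"
  unfolding comparable_def by auto

section \<open>The gap condition\<close>

lemma Upsilon_continuous:
  assumes "\<psi> \<in> Upsilon"
  shows "continuous_on {0..} \<psi>"
  unfolding continuous_on_sequentially
proof (intro allI ballI impI)
  fix a :: "nat \<Rightarrow> real" and l :: real
  assume l: "l \<in> {0..}" and a: "(\<forall>n. a n \<in> {0..}) \<and> a \<longlonglongrightarrow> l"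
  \<comment> \<open>Comparing with the constant sequence \<open>l\<close> identifies the common limit as \<open>\<psi> l\<close>.\<close>
  have "\<exists>m. (\<lambda>n. \<psi> (a n)) \<longlonglongrightarrow> m \<and> (\<lambda>n::nat. \<psi> l) \<longlonglongrightarrow> m"
    using assms[unfolded Upsilon_def mem_Collect_eq, THEN conjunct2, THEN conjunct2,
        rule_format, of a "\<lambda>_. l"] a l
    by (auto intro: tendsto_const)
  then show "(\<psi> \<circ> a) \<longlonglongrightarrow> \<psi> l"
    unfolding LIMSEQ_const_iff by (auto simp: o_def)
qed

lemma positive_lower_bound_away_from_0:
  fixes \<phi> :: "real \<Rightarrow> real"
  assumes "\<phi> \<in> {0..} \<rightarrow> {0..}"
    and "\<And>t :: nat \<Rightarrow> real. (\<And>n. 0 \<le> t n) \<Longrightarrow> (\<lambda>n. \<phi> (t n)) \<longlonglongrightarrow> 0 \<Longrightarrow> t \<longlonglongrightarrow> 0"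
    and "0 < r"
  shows "\<exists>\<eta>>0. \<forall>t\<ge>r. \<eta> \<le> \<phi> t"
proof (rule ccontr)
  assume "\<not> ?thesis"
  then have "\<forall>n. \<exists>t\<ge>r. \<phi> t < inverse (real (Suc n))"
    by (metis inverse_positive_iff_positive not_le of_nat_0_less_iff zero_less_Suc)
  then obtain t where t: "\<And>n. r \<le> t n" "\<And>n. \<phi> (t n) < inverse (real (Suc n))"
    by metis
  have nonneg: "0 \<le> t n" for n
    using t(1)[of n] \<open>0 < r\<close> by linarith
  have "0 \<le> \<phi> (t n)" for n
    using assms(1) nonneg[of n] by auto
  then have "\<forall>\<^sub>F n in sequentially. 0 \<le> \<phi> (t n)"
    "\<forall>\<^sub>F n in sequentially. \<phi> (t n) \<le> inverse (real (Suc n))"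
    using t(2) less_imp_le by (intro always_eventually allI; blast)+
  then have "(\<lambda>n. \<phi> (t n)) \<longlonglongrightarrow> 0"
    by (rule tendsto_sandwich[OF _ _ tendsto_const LIMSEQ_inverse_real_of_nat])
  then have "t \<longlonglongrightarrow> 0"
    using assms(2) nonneg by blast
  then have "r \<le> 0"
    using t(1) by (intro LIMSEQ_le_const) auto
  then show False
    using \<open>0 < r\<close> by linarith
qed

text \<open>The same \<open>d\<close> serves on both sides of \<open>e\<close>.  The Meir--Keeler condition has \<open>e\<close> in place
  of \<open>e - d\<close> in the conclusion; the stronger form survives the passage to limits, where strict
  inequalities become weak.\<close>

locale gap_contraction =
  fixes S T :: "'a::{metric_space,order} \<Rightarrow> 'a set"
  assumes bounded_S: "S x \<in> bounded_sets"
    and bounded_T: "T x \<in> bounded_sets"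
    and gap: "0 < e \<Longrightarrow> \<exists>d>0. \<forall>x y. comparable x y \<longrightarrow> M S T x y < e + d \<longrightarrow>
      delta (S x) (T y) < e - d"

text \<open>Near \<open>e\<close> the function \<open>\<psi>\<close> oscillates by less than the lower bound \<open>\<eta>\<close> of \<open>\<phi>\<close> on
  \<open>{e / 2..}\<close>, which gives the gap if \<open>M\<close> lies within \<open>d\<close> of \<open>e\<close>.  If \<open>M\<close> is smaller than
  \<open>e - d\<close>, monotonicity of \<open>\<psi>\<close> suffices: a larger \<open>delta\<close> would force \<open>\<phi>\<close>, hence \<open>M\<close>, to
  vanish, and then both values are the same singleton.\<close>

lemma weak_contractive_imp_gap:
  fixes S T :: "'a::{metric_space,order} \<Rightarrow> 'a set"
  assumes S: "\<And>x. S x \<in> bounded_sets" and T: "\<And>x. T x \<in> bounded_sets"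
    and \<psi>: "\<psi> \<in> Upsilon"
    and \<phi>: "\<phi> \<in> {0..} \<rightarrow> {0..}"
      "\<And>t :: nat \<Rightarrow> real. (\<And>n. 0 \<le> t n) \<Longrightarrow> (\<lambda>n. \<phi> (t n)) \<longlonglongrightarrow> 0 \<Longrightarrow> t \<longlonglongrightarrow> 0"
    and contr: "generalized_weak_contractive \<psi> \<phi> S T"
  shows "gap_contraction S T"
proof
  fix e :: real
  assume e: "0 < e"
  obtain \<eta> where \<eta>: "0 < \<eta>" "\<And>t. e / 2 \<le> t \<Longrightarrow> \<eta> \<le> \<phi> t"
    using positive_lower_bound_away_from_0[OF \<phi>, of "e / 2"] e by auto
  have "mono_on {0..} \<psi>"
    using \<psi> unfolding Upsilon_def by blast
  then have mono: "\<psi> s \<le> \<psi> t" if "0 \<le> s" "s \<le> t" for s t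
    using that by (intro mono_onD[of "{0..}" \<psi>]) auto
  obtain r where r: "0 < r" "\<And>t. 0 \<le> t \<Longrightarrow> dist t e < r \<Longrightarrow> dist (\<psi> t) (\<psi> e) < \<eta> / 2"
    using Upsilon_continuous[OF \<psi>] e \<eta>(1) unfolding continuous_on_iff
    by (metis atLeast_iff half_gt_zero less_imp_le)
  define d where "d = min (e / 2) (r / 2)"
  have d: "0 < d" "d \<le> e / 2" "d < r"
    using e r(1) by (auto simp: d_def)
  have "delta (S x) (T y) < e - d" if xy: "comparable x y" and small: "M S T x y < e + d" for x y
  proof (rule ccontr)
    assume "\<not> delta (S x) (T y) < e - d"
    then have large: "e - d \<le> delta (S x) (T y)" by simp
    have M0: "0 \<le> M S T x y"
      using M_ge(1)[of x y S T] zero_le_dist[of x y] by linarith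
    have le: "\<psi> (delta (S x) (T y)) \<le> \<psi> (M S T x y) - \<phi> (M S T x y)"
      using contr xy unfolding generalized_weak_contractive_def by blast
    show False
    proof (cases "e - d \<le> M S T x y")
      case True
      have "dist (\<psi> (M S T x y)) (\<psi> e) < \<eta> / 2"
        using True small d M0 by (intro r(2)) (auto simp: dist_real_def)
      moreover have "dist (\<psi> (e - d)) (\<psi> e) < \<eta> / 2"
        using d by (intro r(2)) (auto simp: dist_real_def)
      moreover have "\<eta> \<le> \<phi> (M S T x y)"
        using True d by (intro \<eta>(2)) linarith
      moreover have "\<psi> (e - d) \<le> \<psi> (delta (S x) (T y))"
        using large d by (intro mono) auto
      ultimately show False
        using le unfolding dist_real_def by linarith
    next
      case False
      then have "\<psi> (M S T x y) \<le> \<psi> (delta (S x) (T y))"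
        using large M0 by (intro mono) auto
      then have "\<phi> (M S T x y) \<le> 0"
        using le by linarith
      moreover have "0 \<le> \<phi> (M S T x y)"
        using \<phi>(1) M0 by (simp add: Pi_iff)
      ultimately have "\<phi> (M S T x y) = 0"
        by linarith
      then have "(\<lambda>n::nat. M S T x y) \<longlonglongrightarrow> 0"
        using \<phi>(2)[of "\<lambda>_. M S T x y"] M0 by simp
      then have M_zero: "M S T x y = 0"
        by (simp add: LIMSEQ_const_iff)
      have "S x = {x}" "T y = {y}"
        using M_ge(2)[of x S T y] M_ge(3)[of y T S x] M_zero S T
        by (simp_all add: delta_singleton_nonpos_imp_eq)
      moreover have "x = y"
        using M_ge(1)[of x y S T] M_zero by simp
      ultimately have "delta (S x) (T y) = 0"
        by simp
      then show False
        using large d e by linarith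
    qed
  qed
  then show "\<exists>d>0. \<forall>x y. comparable x y \<longrightarrow> M S T x y < e + d \<longrightarrow> delta (S x) (T y) < e - d"
    using d(1) by blast
qed (fact S T)+

context gap_contraction
begin

lemma delta_less_if_M_le:
  assumes "comparable x y" "M S T x y \<le> e" "0 < e"
  shows "delta (S x) (T y) < e"
proof -
  obtain d where d: "0 < d" "comparable x y \<longrightarrow> M S T x y < e + d \<longrightarrow> delta (S x) (T y) < e - d"
    using gap[OF assms(3)] by blast
  then have "delta (S x) (T y) < e - d"
    using assms by auto
  then show ?thesis
    using d(1) by linarith
qed

section \<open>Alternating decreasing orbits\<close>

definition G :: "nat \<Rightarrow> 'a \<Rightarrow> 'a set" where
  "G n = (if even n then S else T)"

lemma bounded_G: "G n y \<in> bounded_sets"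
  by (simp add: G_def bounded_S bounded_T)

text \<open>The gap condition is symmetric in \<open>S\<close> and \<open>T\<close>, so one \<open>d\<close> serves for both parities.\<close>

lemma gap_alternating:
  assumes "0 < e"
  obtains d where "0 < d"
    "\<And>p q y z. even p \<noteq> even q \<Longrightarrow> comparable y z \<Longrightarrow> M (G p) (G q) y z < e + d \<Longrightarrow>
      delta (G p y) (G q z) < e - d"
proof -
  obtain d where d: "0 < d"
    "\<And>y z. comparable y z \<Longrightarrow> M S T y z < e + d \<Longrightarrow> delta (S y) (T z) < e - d"
    using gap[OF assms] by blast
  have "delta (T y) (S z) < e - d" if "comparable y z" "M T S y z < e + d" for y z
    using d(2)[of z y] that
    by (simp add: comparable_commute[of y z] M_swap[of T S y z] delta_commute[of "T y"])
  then show thesis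
    using d by (intro that[of d]) (auto simp: G_def split: if_splits)
qed

lemma orbit_exists:
  assumes "partially_dominated S" "partially_dominated T"
  obtains x where "\<And>n. x (Suc n) \<in> G n (x n)" "\<And>n. x (Suc n) \<le> x n"
proof -
  have "\<exists>z. z \<in> G n y \<and> z \<le> y" for n y
    using assms unfolding partially_dominated_def G_def by auto
  then obtain f where f: "\<And>n y. f n y \<in> G n y \<and> f n y \<le> y"
    by metis
  show thesis
    by (rule that[of "rec_nat undefined f"]) (use f in auto)
qed

context
  fixes x :: "nat \<Rightarrow> 'a"
  assumes orbit: "x (Suc n) \<in> G n (x n)"
    and decreasing: "x (Suc n) \<le> x n"
begin

definition step :: "nat \<Rightarrow> real" where
  "step n = delta {x n} (G n (x n))"

lemma step_nonneg: "0 \<le> step n"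
  unfolding step_def by (simp add: delta_nonneg bounded_G)

lemma dist_le_step: "dist (x n) (x (Suc n)) \<le> step n"
  unfolding step_def by (rule dist_le_delta_singleton[OF bounded_G orbit])

lemma orbit_comparable: "comparable (x p) (x q)"
  using lift_Suc_antimono_le[of x, OF decreasing] nat_le_linear[of p q]
  unfolding comparable_def by blast

lemma dist_le_delta_orbit: "dist (x (Suc p)) (x (Suc q)) \<le> delta (G p (x p)) (G q (x q))"
  using bounded_G by (intro dist_le_delta orbit) (auto simp: bounded_sets_def)

text \<open>Each of the two distances to sets is compared with the distance to the next orbit point;
  one exceeds \<open>dist (x p) (x q)\<close> by at most \<open>step q\<close>, the other by at most \<open>step p\<close>, so their
  average exceeds it by at most the larger of the two.\<close>

lemma M_orbit_less:
  assumes "dist (x p) (x q) + step p < c" "dist (x p) (x q) + step q < c"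
  shows "M (G p) (G q) (x p) (x q) < c"
proof -
  have "setdist {x p} (G q (x q)) \<le> dist (x p) (x (Suc q))"
    "setdist {x q} (G p (x p)) \<le> dist (x q) (x (Suc p))"
    by (auto intro: setdist_le_dist orbit)
  moreover have "dist (x p) (x (Suc q)) \<le> dist (x p) (x q) + dist (x q) (x (Suc q))"
    "dist (x q) (x (Suc p)) \<le> dist (x p) (x q) + dist (x p) (x (Suc p))"
    using dist_triangle[of "x p" "x (Suc q)" "x q"] dist_triangle[of "x q" "x (Suc p)" "x p"]
    by (simp_all add: dist_commute)
  ultimately have "(setdist {x p} (G q (x q)) + setdist {x q} (G p (x p))) / 2 < c"
    using dist_le_step[of p] dist_le_step[of q] assms by simp
  moreover have "step p < c" "step q < c" "dist (x p) (x q) < c"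
    using assms step_nonneg[of p] step_nonneg[of q] zero_le_dist[of "x p" "x q"]
    by linarith+
  ultimately show ?thesis
    by (simp add: M_less_iff flip: step_def)
qed

text \<open>For consecutive points a sharper bound holds: \<open>x (Suc n)\<close> belongs to \<open>G n (x n)\<close>, so one of
  the two distances to sets vanishes and the average is at most the larger of the two steps.\<close>

lemma M_consecutive_less:
  assumes "step n < c" "step (Suc n) < c"
  shows "M (G n) (G (Suc n)) (x n) (x (Suc n)) < c"
proof -
  have "setdist {x n} (G (Suc n) (x (Suc n))) \<le> dist (x n) (x (Suc (Suc n)))"
    "setdist {x (Suc n)} (G n (x n)) \<le> dist (x (Suc n)) (x (Suc n))"
    using orbit by (intro setdist_le_dist; blast)+
  then have "(setdist {x n} (G (Suc n) (x (Suc n))) + setdist {x (Suc n)} (G n (x n))) / 2 < c"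
    using dist_triangle[of "x n" "x (Suc (Suc n))" "x (Suc n)"]
      dist_le_step[of n] dist_le_step[of "Suc n"] assms by simp
  then show ?thesis
    using assms dist_le_step[of n] by (simp add: M_less_iff flip: step_def)
qed

lemma step_Suc_le_delta: "step (Suc n) \<le> delta (G n (x n)) (G (Suc n) (x (Suc n)))"
  unfolding step_def by (intro delta_singleton_le bounded_G orbit)

lemma step_decreasing: "step (Suc n) \<le> step n"
proof (rule ccontr)
  assume less: "\<not> step (Suc n) \<le> step n"
  then have "0 < step (Suc n)"
    using step_nonneg[of n] by linarith
  then obtain d where d: "0 < d"
    "\<And>p q y z. even p \<noteq> even q \<Longrightarrow> comparable y z \<Longrightarrow> M (G p) (G q) y z < step (Suc n) + d \<Longrightarrow>
      delta (G p y) (G q z) < step (Suc n) - d"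
    using gap_alternating by blast
  have "delta (G n (x n)) (G (Suc n) (x (Suc n))) < step (Suc n) - d"
    using less d(1) by (intro d(2) M_consecutive_less orbit_comparable) auto
  then show False
    using step_Suc_le_delta[of n] d(1) by linarith
qed

lemma step_tendsto_0: "step \<longlonglongrightarrow> 0"
proof -
  have "decseq step"
    by (rule decseq_SucI) (rule step_decreasing)
  then obtain l where l: "step \<longlonglongrightarrow> l" "\<And>n. l \<le> step n"
    using decseq_convergent[of step 0] step_nonneg by metis
  have "\<not> 0 < l"
  proof
    assume "0 < l"
    then obtain d where d: "0 < d"
      "\<And>p q y z. even p \<noteq> even q \<Longrightarrow> comparable y z \<Longrightarrow> M (G p) (G q) y z < l + d \<Longrightarrow>
        delta (G p y) (G q z) < l - d"
      using gap_alternating by blast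
    have "eventually (\<lambda>n. step n < l + d) sequentially"
      using d(1) by (intro order_tendstoD(2)[OF l(1)]) auto
    then obtain n where n: "step n < l + d"
      using eventually_sequentially by auto
    have "delta (G n (x n)) (G (Suc n) (x (Suc n))) < l - d"
      using n step_decreasing[of n]
      by (intro d(2) M_consecutive_less orbit_comparable) auto
    then show False
      using step_Suc_le_delta[of n] l(2)[of "Suc n"] d(1) by linarith
  qed
  moreover have "0 \<le> l"
    using l(1) step_nonneg by (intro LIMSEQ_le_const) auto
  ultimately show ?thesis
    using l(1) by (simp add: order.antisym not_less)
qed

text \<open>Fix \<open>p\<close> late in the orbit.  The points \<open>x q\<close> with \<open>q\<close> of the other parity stay within
  \<open>e + d / 2\<close> of \<open>x p\<close>: if \<open>x q\<close> does, the gap brings \<open>x (Suc q)\<close> within \<open>e\<close> of \<open>x (Suc p)\<close>, and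
  the two short steps that lead to \<open>x p\<close> and to \<open>x (Suc (Suc q))\<close> cost at most \<open>d / 4\<close> each.
  Advancing by two keeps the parity; one more step reaches the points of the same parity as
  \<open>p\<close>.\<close>

lemma orbit_Cauchy: "Cauchy x"
proof (rule metric_CauchyI)
  fix \<epsilon> :: real
  assume "0 < \<epsilon>"
  define e where "e = \<epsilon> / 2"
  have e: "0 < e" using \<open>0 < \<epsilon>\<close> by (simp add: e_def)
  obtain d0 where d0: "0 < d0"
    "\<And>p q y z. even p \<noteq> even q \<Longrightarrow> comparable y z \<Longrightarrow> M (G p) (G q) y z < e + d0 \<Longrightarrow>
      delta (G p y) (G q z) < e - d0"
    using gap_alternating[OF e] by blast
  define d where "d = min d0 e"
  have d: "0 < d" "d \<le> d0" "d \<le> e"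
    using d0(1) e by (auto simp: d_def)
  obtain N where N: "\<And>n. N \<le> n \<Longrightarrow> step n < d / 4"
    using order_tendstoD(2)[OF step_tendsto_0, of "d / 4"] d(1)
    unfolding eventually_sequentially by auto
  have odd_gap: "dist (x p) (x (p + 2 * k + 1)) < e + d / 2" if p: "N \<le> p" for p k
  proof (induction k)
    case 0
    then show ?case
      using dist_le_step[of p] N[OF p] e d by simp
  next
    case (Suc k)
    let ?q = "p + 2 * k + 1"
    have short: "step p < d / 4" "step ?q < d / 4" "step (Suc ?q) < d / 4"
      using p N[of p] N[of ?q] N[of "Suc ?q"] by simp_all
    have "delta (G p (x p)) (G ?q (x ?q)) < e - d0"
      using Suc short d by (intro d0(2) M_orbit_less orbit_comparable) auto
    then have "dist (x (Suc p)) (x (Suc ?q)) < e"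
      using dist_le_delta_orbit[of p ?q] d0(1) by linarith
    then have "dist (x p) (x (Suc (Suc ?q))) < e + d / 2"
      using dist_triangle[of "x p" "x (Suc (Suc ?q))" "x (Suc p)"]
        dist_triangle[of "x (Suc p)" "x (Suc (Suc ?q))" "x (Suc ?q)"]
        dist_le_step[of p] dist_le_step[of "Suc ?q"] short by linarith
    then show ?case
      by simp
  qed
  have later: "dist (x p) (x q) < \<epsilon>" if p: "N \<le> p" and pq: "p \<le> q" for p q
  proof (cases "even (q - p)")
    case True
    then obtain k where "q - p = 2 * k"
      by (elim evenE)
    then have k: "Suc q = p + 2 * k + 1"
      using pq by linarith
    have "dist (x p) (x (Suc q)) < e + d / 2"
      using odd_gap[OF p, of k] k by simp
    moreover have "step q < d / 4"
      using p pq by (intro N) simp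
    ultimately show ?thesis
      using dist_triangle2[of "x p" "x q" "x (Suc q)"] dist_le_step[of q] d
      by (simp add: e_def)
  next
    case False
    then obtain k where "q - p = 2 * k + 1"
      by (elim oddE)
    then have "q = p + 2 * k + 1"
      using pq by linarith
    then show ?thesis
      using odd_gap[OF p, of k] d e_def by simp
  qed
  show "\<exists>N. \<forall>m\<ge>N. \<forall>n\<ge>N. dist (x m) (x n) < \<epsilon>"
  proof (intro exI allI impI)
    fix m n
    assume "N \<le> m" "N \<le> n"
    then show "dist (x m) (x n) < \<epsilon>"
      using later[of m n] later[of n m] by (cases "m \<le> n") (auto simp: dist_commute)
  qed
qed

text \<open>In \<open>M S T u (x n)\<close> with \<open>n\<close> odd and large, the term \<open>delta {u} (S u)\<close> dominates: the
  distance and the step tend to \<open>0\<close>, and the average of the distances to sets tends to at most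
  half of \<open>delta {u} (S u)\<close>.  Since \<open>u\<close> is nearly in \<open>T (x n)\<close>, the gap, which keeps
  \<open>delta (S u) (T (x n))\<close> a fixed amount below \<open>delta {u} (S u)\<close>, is impossible.\<close>

lemma limit_end_point_S:
  assumes lim: "x \<longlonglongrightarrow> u" and comp: "\<And>n. comparable u (x n)"
  shows "S u = {u}"
proof (rule delta_singleton_nonpos_imp_eq[OF bounded_S], rule ccontr)
  define A where "A = delta {u} (S u)"
  assume "\<not> delta {u} (S u) \<le> 0"
  then have A: "0 < A" by (simp add: A_def)
  obtain d where d: "0 < d"
    "\<And>y z. comparable y z \<Longrightarrow> M S T y z < A + d \<Longrightarrow> delta (S y) (T z) < A - d"
    using gap[OF A] by blast
  define r where "r = min d A"
  have r: "0 < r" "r \<le> d" "r \<le> A"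
    using d(1) A by (auto simp: r_def)
  have "eventually (\<lambda>n. step n < r) sequentially"
    by (rule order_tendstoD(2)[OF step_tendsto_0 r(1)])
  moreover have "eventually (\<lambda>n. dist (x n) u < r / 2) sequentially"
    using r(1) by (intro tendstoD[OF lim]) simp
  ultimately obtain N where N: "\<And>n. N \<le> n \<Longrightarrow> step n < r \<and> dist (x n) u < r / 2"
    unfolding eventually_sequentially by (metis (no_types, lifting) le_trans nle_le)
  \<comment> \<open>An odd index, because the orbit takes its next point from \<open>T\<close> there.\<close>
  define n where "n = 2 * N + 1"
  have n: "odd n" "step n < r" "dist (x n) u < r / 2" "dist (x (Suc n)) u < r / 2"
    using N[of n] N[of "Suc n"] by (auto simp: n_def)
  have G: "G n = T"
    using n(1) by (simp add: G_def)
  have next_T: "x (Suc n) \<in> T (x n)"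
    using orbit[of n] G by simp
  obtain s where s: "s \<in> S u"
    using bounded_S[of u] unfolding bounded_sets_def by auto
  have "dist u s \<le> A"
    unfolding A_def by (rule dist_le_delta_singleton[OF bounded_S s])
  then have "setdist {x n} (S u) \<le> dist (x n) u + A"
    using setdist_le_dist[of "x n" "{x n}" s "S u"] s dist_triangle[of "x n" s u] by simp
  moreover have "setdist {u} (T (x n)) \<le> dist (x (Suc n)) u"
    using setdist_le_dist[OF singletonI next_T, of u] by (simp add: dist_commute)
  ultimately have "(setdist {u} (T (x n)) + setdist {x n} (S u)) / 2 < A + d"
    using n r A by simp
  then have "M S T u (x n) < A + d"
    using n(2,3) r A d(1) G by (simp add: M_less_iff step_def dist_commute flip: A_def)
  then have small: "delta (S u) (T (x n)) < A - d"
    by (intro d(2) comp)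
  have "A \<le> dist u (x (Suc n)) + delta (S u) (T (x n))"
    unfolding A_def
  proof (rule delta_least)
    fix a b
    assume "a \<in> {u}" "b \<in> S u"
    moreover from \<open>b \<in> S u\<close> have "dist b (x (Suc n)) \<le> delta (S u) (T (x n))"
      using bounded_S[of u] bounded_T[of "x n"] next_T
      by (intro dist_le_delta) (auto simp: bounded_sets_def)
    ultimately show "dist a b \<le> dist u (x (Suc n)) + delta (S u) (T (x n))"
      using dist_triangle2[of u b "x (Suc n)"] by simp
  qed (use s in auto)
  then show False
    using small n(4) r d(1) by (simp add: dist_commute)
qed

end

section \<open>Common end points\<close>

text \<open>At an end point \<open>u\<close> of \<open>S\<close>, both \<open>M S T u u\<close> and \<open>delta (S u) (T u)\<close> equal
  \<open>delta {u} (T u)\<close>, which must therefore vanish.\<close>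

lemma end_point_S_imp_T:
  assumes "S u = {u}"
  shows "T u = {u}"
proof (rule delta_singleton_nonpos_imp_eq[OF bounded_T], rule ccontr)
  let ?e = "delta {u} (T u)"
  assume pos: "\<not> ?e \<le> 0"
  obtain t where t: "t \<in> T u"
    using bounded_T[of u] unfolding bounded_sets_def by auto
  have "setdist {u} (T u) \<le> ?e"
    using setdist_le_dist[OF singletonI t, of u] dist_le_delta_singleton[OF bounded_T t, of u]
    by linarith
  then have "M S T u u \<le> ?e"
    using pos assms unfolding M_def by (subst Max_le_iff) auto
  then have "delta (S u) (T u) < ?e"
    using pos by (intro delta_less_if_M_le) (auto simp: comparable_def)
  then show False
    by (simp add: assms)
qed

lemma common_end_point_unique:
  assumes "common_end_point S T u" "common_end_point S T v" "comparable u v"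
  shows "u = v"
proof (rule ccontr)
  assume "u \<noteq> v"
  have ends: "S u = {u}" "T v = {v}"
    using assms by (auto simp: common_end_point_def)
  have "M S T u v = dist u v"
    unfolding M_def ends by (simp add: dist_commute max_def)
  then have "delta (S u) (T v) < dist u v"
    using \<open>u \<noteq> v\<close> assms(3) by (intro delta_less_if_M_le) auto
  then show False
    by (simp add: ends)
qed

end

theorem theorem1:
  fixes S T :: "'a::complete_ordered_Ldown_metric_space \<Rightarrow> 'a set"
    and \<psi> \<phi> :: "real \<Rightarrow> real"
  assumes "\<And>x. S x \<in> bounded_sets" and "\<And>x. T x \<in> bounded_sets"
    and "partially_dominated T" and "partially_dominated S"
    and "\<psi> \<in> Upsilon"
    and "\<phi> \<in> {0..} \<rightarrow> {0..}"
    and "\<And>t :: nat \<Rightarrow> real. (\<And>n. 0 \<le> t n) \<Longrightarrow> (\<lambda>n. \<phi> (t n)) \<longlonglongrightarrow> 0 \<Longrightarrow> t \<longlonglongrightarrow> 0"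
    and "generalized_weak_contractive \<psi> \<phi> S T"
  shows "(\<exists>u. {u} = T u \<and> T u = S u) \<and>
    (end_points_comparable S T \<longrightarrow> (\<exists>!u. common_end_point S T u))"
proof -
  interpret gap_contraction S T
    using assms(1,2,5-8) by (rule weak_contractive_imp_gap)
  obtain x where x: "\<And>n. x (Suc n) \<in> G n (x n)" "\<And>n. x (Suc n) \<le> x n"
    using orbit_exists[OF assms(4,3)] by blast
  have "Cauchy x"
    by (rule orbit_Cauchy) (fact x)+
  then obtain u where u: "x \<longlonglongrightarrow> u"
    using Cauchy_convergent convergent_def by blast
  have "comparable u (x n)" for n
    using Ldown[OF u x(2)] by (simp add: comparable_def)
  then have "S u = {u}"
    using u by (intro limit_end_point_S[of x]) (use x in auto)
  then have S: "S u = {u}" and T: "T u = {u}"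
    using end_point_S_imp_T by auto
  have "\<exists>!u. common_end_point S T u" if "end_points_comparable S T"
  proof (rule ex1I[of _ u])
    show u: "common_end_point S T u"
      using S T by (simp add: common_end_point_def)
    fix v
    assume v: "common_end_point S T v"
    then have "comparable v u"
      using u that unfolding end_points_comparable_def end_point_def common_end_point_def by blast
    then show "v = u"
      using u v common_end_point_unique by blast
  qed
  then show ?thesis
    using S T by auto
qed

end
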